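(* There are no maximal and no timelike minimal surfaces in $\mathbb{E}_1^3$ which can be parametrized as a modular surface over some domain in the $xy$-plane, except for plane sections. That is: let $D\subset\mathbb{C}$ be a domain, let $F=f^2$ with $f$ analytic on $D$, and let $M$ be the modular surface in $\mathbb{E}_1^3$ generated by $F$; if either $|F'|<1$ on $D$ (spacelike) or $|F'|>1$ on $D$ (timelike), and the mean curvature $H$ of $M$ vanishes identically on $D$, then $M$ is contained in a plane.
   Context: $\mathbb{E}_1^3$ denotes $\mathbb{R}^3$ with the Lorentzian metric $dx^2+dy^2-dt^2$. A domain is an open connected subset of $\mathbb{C}$, and $(x,y)$ is identified with $z=x+iy$. The modular surface generated by an analytic function $F$ on $D$ is the graph $(x,y,h(x,y))$, $x+iy\in D$, with $h=|F|$. One has $h_x^2+h_y^2=|F'|^2$; the surface is spacelike where $|F'|<1$ and timelike where $|F'|>1$. The mean curvature is $$H=-\frac{(1-h_y^2)h_{xx}+2h_xh_yh_{xy}+(1-h_x^2)h_{yy}}{2|1-h_x^2-h_y^2|^{3/2}}.$$ A spacelike surface with $H\equiv0$ is called maximal; a timelike surface with $H\equiv 0$ is called timelike minimal. *)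

theory Defs
  imports "HOL-Complex_Analysis.Complex_Analysis"
begin

text \<open>
  The \<open>xy\<close>-plane is identified with the complex numbers via \<open>z = x + i y\<close>, and the
  coordinates \<open>(x, y, t)\<close> of the Lorentzian space with metric \<open>dx^2 + dy^2 - dt^2\<close> are the
  components of \<^typ>\<open>real ^ 3\<close>. The metric enters only through the mean curvature and the causal
  character below; the Euclidean inner product of \<^typ>\<open>real ^ 3\<close> plays no role.
\<close>

definition partial_x :: "(complex \<Rightarrow> real) \<Rightarrow> complex \<Rightarrow> real" where
  "partial_x h z = deriv (\<lambda>x. h (Complex x (Im z))) (Re z)"

definition partial_y :: "(complex \<Rightarrow> real) \<Rightarrow> complex \<Rightarrow> real" where
  "partial_y h z = deriv (\<lambda>y. h (Complex (Re z) y)) (Im z)"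

definition modular_height :: "(complex \<Rightarrow> complex) \<Rightarrow> complex \<Rightarrow> real" where
  "modular_height F z = cmod (F z)"

definition modular_surface :: "complex set \<Rightarrow> (complex \<Rightarrow> complex) \<Rightarrow> (real ^ 3) set" where
  "modular_surface D F = (\<lambda>z. vector [Re z, Im z, modular_height F z]) ` D"

text \<open>Mean curvature, with respect to the Lorentzian metric, of the graph \<open>t = h(x, y)\<close> at a point
  where the induced metric is nondegenerate, i.e. \<open>h_x^2 + h_y^2 \<noteq> 1\<close>.\<close>

definition lorentz_mean_curvature :: "(complex \<Rightarrow> real) \<Rightarrow> complex \<Rightarrow> real" where
  "lorentz_mean_curvature h z =
    - ((1 - (partial_y h z)\<^sup>2) * partial_x (partial_x h) z
       + 2 * partial_x h z * partial_y h z * partial_y (partial_x h) z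
       + (1 - (partial_x h z)\<^sup>2) * partial_y (partial_y h) z)
      / (2 * \<bar>1 - (partial_x h z)\<^sup>2 - (partial_y h z)\<^sup>2\<bar> powr (3 / 2))"

text \<open>The metric induced on the graph of \<open>h = |F|\<close> has determinant
  \<open>1 - h_x^2 - h_y^2 = 1 - |F'|^2\<close>; it is positive definite (the surface is spacelike) where this is
  positive, and indefinite (timelike) where it is negative.\<close>

definition spacelike_modular_surface :: "complex set \<Rightarrow> (complex \<Rightarrow> complex) \<Rightarrow> bool" where
  "spacelike_modular_surface D F \<longleftrightarrow> (\<forall>z\<in>D. cmod (deriv F z) < 1)"

definition timelike_modular_surface :: "complex set \<Rightarrow> (complex \<Rightarrow> complex) \<Rightarrow> bool" where
  "timelike_modular_surface D F \<longleftrightarrow> (\<forall>z\<in>D. cmod (deriv F z) > 1)"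

definition maximal_modular_surface :: "complex set \<Rightarrow> (complex \<Rightarrow> complex) \<Rightarrow> bool" where
  "maximal_modular_surface D F \<longleftrightarrow>
    spacelike_modular_surface D F \<and> (\<forall>z\<in>D. lorentz_mean_curvature (modular_height F) z = 0)"

definition timelike_minimal_modular_surface :: "complex set \<Rightarrow> (complex \<Rightarrow> complex) \<Rightarrow> bool" where
  "timelike_minimal_modular_surface D F \<longleftrightarrow>
    timelike_modular_surface D F \<and> (\<forall>z\<in>D. lorentz_mean_curvature (modular_height F) z = 0)"

end

theory Submission
  imports Defs
begin

text \<open>
  Write \<open>h = |F| = f \<cdot> cnj f\<close>. Since \<open>F\<close> is a square, \<open>h\<close> is smooth even at the zeros of \<open>F\<close>, and
  the numerator of the mean curvature is a polynomial in \<open>f\<close>, \<open>f'\<close>, \<open>f''\<close> and their conjugates.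
  Where \<open>f' \<noteq> 0\<close>, the equation \<open>H = 0\<close> forces \<open>f \<noteq> 0\<close> and reads
  \<open>Re (2 (1 - f f'' / f'\<^sup>2)) = |1 / (f f')|\<^sup>2\<close>,
  an equality between the real part of an analytic function \<open>A\<close> and the squared modulus of an
  analytic function \<open>B\<close>. The left side is harmonic and the Laplacian of the right side is
  \<open>4 |B'|\<^sup>2\<close>, so \<open>B' = 0\<close> (lemma \<open>Re_eq_norm_squared_imp_deriv_zero\<close>). For \<open>B = 1 / (f f')\<close> this
  says \<open>f'\<^sup>2 + f f'' = 0\<close>; then \<open>A = 4\<close>, so \<open>|F'| = 2 |f f'| = 1\<close>, and the surface would be
  lightlike there. As the causal character excludes this, \<open>f'\<close> vanishes on all of \<open>D\<close>. Hence the
  only surfaces in question are pieces of horizontal planes, and none of them is timelike.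
\<close>

section \<open>Real parts of analytic functions that are squared moduli\<close>

lemma has_derivative_Re_mult_cnj:
  assumes "(f has_field_derivative a) (at z)" "(g has_field_derivative b) (at z)"
  shows "((\<lambda>w. Re (f w * cnj (g w))) has_derivative
          (\<lambda>v. Re (a * v * cnj (g z) + f z * cnj (b * v)))) (at z)"
proof -
  have "(f has_derivative (\<lambda>v. a * v)) (at z)" "(g has_derivative (\<lambda>v. b * v)) (at z)"
    using assms by (simp_all add: has_field_derivative_def)
  then show ?thesis
    by (auto intro!: derivative_eq_intros simp: algebra_simps)
qed

lemma has_derivative_Im_mult_cnj:
  assumes "(f has_field_derivative a) (at z)" "(g has_field_derivative b) (at z)"
  shows "((\<lambda>w. Im (f w * cnj (g w))) has_derivative
          (\<lambda>v. Im (a * v * cnj (g z) + f z * cnj (b * v)))) (at z)"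
proof -
  have "(f has_derivative (\<lambda>v. a * v)) (at z)" "(g has_derivative (\<lambda>v. b * v)) (at z)"
    using assms by (simp_all add: has_field_derivative_def)
  then show ?thesis
    by (auto intro!: derivative_eq_intros simp: algebra_simps)
qed

text \<open>
  Comparing the derivatives of \<open>G\<close> in the directions \<open>1\<close> and \<open>\<i>\<close>: the part of the derivative of
  \<open>P \<cdot> cnj Q\<close> that is conjugate-linear must vanish. This is the Wirtinger equation
  \<open>\<partial>(P \<cdot> cnj Q)/\<partial>(cnj z) = 0\<close>.
\<close>

lemma analytic_eq_mult_cnj_imp_deriv_zero:
  fixes G P Q :: "complex \<Rightarrow> complex"
  assumes "open S" "z \<in> S"
    and "\<And>w. w \<in> S \<Longrightarrow> G w = P w * cnj (Q w)"
    and G: "(G has_field_derivative g) (at z)"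
    and P: "(P has_field_derivative p) (at z)"
    and Q: "(Q has_field_derivative q) (at z)"
  shows "P z * cnj q = 0"
proof -
  have "((\<lambda>w. P w * cnj (Q w)) has_derivative
         (\<lambda>v. p * v * cnj (Q z) + P z * cnj (q * v))) (at z)"
    using P Q unfolding has_field_derivative_def
    by (auto intro!: derivative_eq_intros simp: algebra_simps)
  then have "(G has_derivative (\<lambda>v. p * v * cnj (Q z) + P z * cnj (q * v))) (at z)"
    by (rule has_derivative_transform_within_open[OF _ assms(1,2)]) (simp add: assms(3))
  with G have eq: "(\<lambda>v. g * v) = (\<lambda>v. p * v * cnj (Q z) + P z * cnj (q * v))"
    unfolding has_field_derivative_def by (rule has_derivative_unique)
  have one: "g = p * cnj (Q z) + P z * cnj q"
    using fun_cong[OF eq, of 1] by simp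
  have i: "g * \<i> = p * \<i> * cnj (Q z) + P z * (cnj q * - \<i>)"
    using fun_cong[OF eq, of \<i>] by simp
  have "2 * \<i> * (P z * cnj q) = 0"
    using i unfolding one by (simp add: algebra_simps)
  then show ?thesis by simp
qed

text \<open>
  The first derivatives of \<open>Re A = |B|\<^sup>2\<close> amount to the complex equation \<open>A' = 2 B' \<cdot> cnj B\<close>, whose
  left side is analytic; so the conjugate derivative \<open>2 B' \<cdot> cnj B'\<close> of the right side is zero.
\<close>

lemma Re_eq_norm_squared_imp_deriv_zero:
  fixes A B :: "complex \<Rightarrow> complex"
  assumes S: "open S" and A: "A holomorphic_on S" and B: "B holomorphic_on S"
    and eq: "\<And>z. z \<in> S \<Longrightarrow> Re (A z) = (cmod (B z))\<^sup>2"
    and "z \<in> S"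
  shows "deriv B z = 0"
proof -
  have first_order: "deriv A w = 2 * deriv B w * cnj (B w)" if w: "w \<in> S" for w
  proof -
    have dB: "(B has_field_derivative deriv B w) (at w)"
      and dA: "(A has_field_derivative deriv A w) (at w)"
      using holomorphic_derivI[OF B S w] holomorphic_derivI[OF A S w] by auto
    have "((\<lambda>u. Re (A u)) has_derivative
           (\<lambda>v. Re (deriv B w * v * cnj (B w) + B w * cnj (deriv B w * v)))) (at w)"
      by (rule has_derivative_transform_within_open[OF has_derivative_Re_mult_cnj[OF dB dB] S w])
        (simp only: eq complex_norm_square[symmetric] Re_complex_of_real)
    moreover have "((\<lambda>u. Re (A u)) has_derivative (\<lambda>v. Re (deriv A w * v))) (at w)"
      using dA unfolding has_field_derivative_def by (auto intro!: derivative_eq_intros)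
    ultimately have D: "(\<lambda>v. Re (deriv B w * v * cnj (B w) + B w * cnj (deriv B w * v)))
        = (\<lambda>v. Re (deriv A w * v))"
      by (rule has_derivative_unique)
    show ?thesis
      using fun_cong[OF D, of 1] fun_cong[OF D, of \<i>]
      by (simp add: complex_eq_iff algebra_simps)
  qed
  have hol: "deriv A holomorphic_on S" "deriv B holomorphic_on S"
    using A B S by (auto intro: holomorphic_deriv)
  have P: "((\<lambda>w. 2 * deriv B w) has_field_derivative 2 * deriv (deriv B) z) (at z)"
    using holomorphic_derivI[OF hol(2) S \<open>z \<in> S\<close>] by (rule DERIV_cmult)
  have "2 * deriv B z * cnj (deriv B z) = 0"
    by (rule analytic_eq_mult_cnj_imp_deriv_zero[OF S \<open>z \<in> S\<close> first_order
          holomorphic_derivI[OF hol(1) S \<open>z \<in> S\<close>] P holomorphic_derivI[OF B S \<open>z \<in> S\<close>]])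
  then show ?thesis by simp
qed

section \<open>The vanishing of the mean curvature in terms of \<open>f\<close>\<close>

lemma partial_x_eq:
  assumes "(h has_derivative L) (at z)"
  shows "partial_x h z = L 1"
proof -
  have line: "((\<lambda>x. Complex x (Im z)) has_derivative (\<lambda>t. of_real t)) (at (Re z))"
    unfolding Complex_eq by (auto intro!: derivative_eq_intros)
  have "((\<lambda>x. h (Complex x (Im z))) has_derivative (\<lambda>t. L (of_real t))) (at (Re z))"
    using has_derivative_compose[OF line, of h L] assms by simp
  moreover have "(\<lambda>t. L (of_real t)) = (\<lambda>t. L 1 * t)"
    using linear_scale[OF has_derivative_linear[OF assms], of _ 1]
    by (simp add: scaleR_conv_of_real mult.commute)
  ultimately show ?thesis
    unfolding partial_x_def by (intro DERIV_imp_deriv) (simp add: has_field_derivative_def)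
qed

lemma partial_y_eq:
  assumes "(h has_derivative L) (at z)"
  shows "partial_y h z = L \<i>"
proof -
  have line: "((\<lambda>y. Complex (Re z) y) has_derivative (\<lambda>t. of_real t * \<i>)) (at (Im z))"
    unfolding Complex_eq by (auto intro!: derivative_eq_intros)
  have "((\<lambda>y. h (Complex (Re z) y)) has_derivative (\<lambda>t. L (of_real t * \<i>))) (at (Im z))"
    using has_derivative_compose[OF line, of h L] assms by simp
  moreover have "(\<lambda>t. L (of_real t * \<i>)) = (\<lambda>t. L \<i> * t)"
    using linear_scale[OF has_derivative_linear[OF assms], of _ \<i>]
    by (simp add: scaleR_conv_of_real mult.commute)
  ultimately show ?thesis
    unfolding partial_y_def by (intro DERIV_imp_deriv) (simp add: has_field_derivative_def)
qed

text \<open>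
  All values are read off from \<open>h = f \<cdot> cnj f\<close> in Wirtinger form: \<open>h\<^sub>x - \<i> h\<^sub>y = 2 f' \<cdot> cnj f\<close>,
  \<open>h\<^sub>x\<^sub>x - h\<^sub>y\<^sub>y - 2 \<i> h\<^sub>x\<^sub>y = 4 f'' \<cdot> cnj f\<close>, and the Laplacian of \<open>h\<close> is \<open>4 |f'|\<^sup>2\<close>.
\<close>

lemma partials_modular_height_square:
  assumes D: "open D" and f: "f holomorphic_on D"
    and F: "\<forall>z\<in>D. F z = (f z)\<^sup>2" and z: "z \<in> D"
  defines "h \<equiv> modular_height F"
  shows "partial_x h z = 2 * Re (deriv f z * cnj (f z))"
    and "partial_y h z = - 2 * Im (deriv f z * cnj (f z))"
    and "partial_x (partial_x h) z
          = 2 * Re (deriv (deriv f) z * cnj (f z)) + 2 * (cmod (deriv f z))\<^sup>2"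
    and "partial_y (partial_x h) z = - 2 * Im (deriv (deriv f) z * cnj (f z))"
    and "partial_y (partial_y h) z
          = - 2 * Re (deriv (deriv f) z * cnj (f z)) + 2 * (cmod (deriv f z))\<^sup>2"
proof -
  have df: "(f has_field_derivative deriv f w) (at w)" if "w \<in> D" for w
    using holomorphic_derivI[OF f D that] .
  have "deriv f holomorphic_on D" using f D by (rule holomorphic_deriv)
  then have ddf: "(deriv f has_field_derivative deriv (deriv f) z) (at z)"
    using D z by (rule holomorphic_derivI)
  have dh: "(h has_derivative
      (\<lambda>v. Re (deriv f w * v * cnj (f w) + f w * cnj (deriv f w * v)))) (at w)"
    if w: "w \<in> D" for w
  proof (rule has_derivative_transform_within_open
      [OF has_derivative_Re_mult_cnj[OF df[OF w] df[OF w]] D w])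
    fix u assume "u \<in> D"
    then show "Re (f u * cnj (f u)) = h u"
      by (simp only: h_def modular_height_def F norm_power
          complex_norm_square[symmetric] Re_complex_of_real)
  qed
  have hx: "partial_x h w = 2 * Re (deriv f w * cnj (f w))" if "w \<in> D" for w
    using partial_x_eq[OF dh[OF that]] by (simp add: algebra_simps)
  have hy: "partial_y h w = - 2 * Im (deriv f w * cnj (f w))" if "w \<in> D" for w
    using partial_y_eq[OF dh[OF that]] by (simp add: algebra_simps)
  show "partial_x h z = 2 * Re (deriv f z * cnj (f z))" using hx[OF z] .
  show "partial_y h z = - 2 * Im (deriv f z * cnj (f z))" using hy[OF z] .
  have dhx: "(partial_x h has_derivative
      (\<lambda>v. 2 * Re (deriv (deriv f) z * v * cnj (f z) + deriv f z * cnj (deriv f z * v)))) (at z)"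
    by (rule has_derivative_transform_within_open
        [OF has_derivative_mult_right[OF has_derivative_Re_mult_cnj[OF ddf df[OF z]]] D z])
      (simp add: hx)
  have dhy: "(partial_y h has_derivative
      (\<lambda>v. - 2 * Im (deriv (deriv f) z * v * cnj (f z) + deriv f z * cnj (deriv f z * v)))) (at z)"
    by (rule has_derivative_transform_within_open
        [OF has_derivative_mult_right[OF has_derivative_Im_mult_cnj[OF ddf df[OF z]]] D z])
      (simp add: hy)
  show "partial_x (partial_x h) z
          = 2 * Re (deriv (deriv f) z * cnj (f z)) + 2 * (cmod (deriv f z))\<^sup>2"
    unfolding partial_x_eq[OF dhx] cmod_power2 by (simp add: algebra_simps power2_eq_square)
  show "partial_y (partial_x h) z = - 2 * Im (deriv (deriv f) z * cnj (f z))"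
    unfolding partial_y_eq[OF dhx] by (simp add: algebra_simps)
  show "partial_y (partial_y h) z
          = - 2 * Re (deriv (deriv f) z * cnj (f z)) + 2 * (cmod (deriv f z))\<^sup>2"
    unfolding partial_y_eq[OF dhy] cmod_power2 by (simp add: algebra_simps power2_eq_square)
qed

text \<open>
  With \<open>a\<close>, \<open>p\<close>, \<open>q\<close> standing for \<open>f\<close>, \<open>f'\<close>, \<open>f''\<close> at a point, the left side is the numerator of the
  mean curvature. It equals \<open>(1 - |\<nabla>h|\<^sup>2) \<Delta>h + (h\<^sub>x\<^sup>2 h\<^sub>x\<^sub>x + 2 h\<^sub>x h\<^sub>y h\<^sub>x\<^sub>y + h\<^sub>y\<^sup>2 h\<^sub>y\<^sub>y)\<close>, where
  \<open>\<Delta>h = 4 |p|\<^sup>2\<close>, \<open>|\<nabla>h|\<^sup>2 = 4 |p|\<^sup>2 |a|\<^sup>2\<close>, and the bracket is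
  \<open>|\<nabla>h|\<^sup>2 \<Delta>h / 2 + 8 |a|\<^sup>2 Re ((cnj p)\<^sup>2 a q)\<close>.
\<close>

lemma curvature_numerator_identity:
  fixes a p q :: complex
  defines "hx \<equiv> 2 * Re (p * cnj a)" and "hy \<equiv> - 2 * Im (p * cnj a)"
    and "hxx \<equiv> 2 * Re (q * cnj a) + 2 * (cmod p)\<^sup>2"
    and "hxy \<equiv> - 2 * Im (q * cnj a)"
    and "hyy \<equiv> - 2 * Re (q * cnj a) + 2 * (cmod p)\<^sup>2"
  shows "(1 - hy\<^sup>2) * hxx + 2 * hx * hy * hxy + (1 - hx\<^sup>2) * hyy
    = 4 * ((cmod p)\<^sup>2 - 2 * ((cmod p)\<^sup>2)\<^sup>2 * (cmod a)\<^sup>2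
           + 2 * (cmod a)\<^sup>2 * Re ((cnj p)\<^sup>2 * a * q))"
  unfolding assms cmod_power2
  by (simp add: power2_eq_square) algebra

text \<open>
  Dividing the numerator by \<open>4 |p|\<^sup>4 |a|\<^sup>2\<close>. This is possible because at \<open>a = 0\<close> the numerator is
  \<open>4 |p|\<^sup>2 \<noteq> 0\<close>.
\<close>

lemma curvature_numerator_zero_normal_form:
  fixes a p q :: complex
  assumes zero: "(cmod p)\<^sup>2 - 2 * ((cmod p)\<^sup>2)\<^sup>2 * (cmod a)\<^sup>2
           + 2 * (cmod a)\<^sup>2 * Re ((cnj p)\<^sup>2 * a * q) = 0"
    and p: "p \<noteq> 0"
  shows "a \<noteq> 0" and "Re (2 * (1 - a * q / p\<^sup>2)) = (cmod (1 / (a * p)))\<^sup>2"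
proof -
  show a: "a \<noteq> 0"
    using zero p by auto
  have Re_scaled: "Re (of_real r * c) = r * Re c" for r c
    by simp
  have "(cnj p)\<^sup>2 * p\<^sup>2 = of_real (((cmod p)\<^sup>2)\<^sup>2)"
    unfolding of_real_power[of "(cmod p)\<^sup>2"] complex_norm_square
    by (simp add: power_mult_distrib)
  then have "(cnj p)\<^sup>2 = of_real (((cmod p)\<^sup>2)\<^sup>2) / p\<^sup>2"
    using p by (simp add: field_simps)
  then have "(cnj p)\<^sup>2 * a * q = of_real (((cmod p)\<^sup>2)\<^sup>2) * (a * q / p\<^sup>2)"
    by simp
  then have "Re ((cnj p)\<^sup>2 * a * q) = ((cmod p)\<^sup>2)\<^sup>2 * Re (a * q / p\<^sup>2)"
    by (simp only: Re_scaled)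
  from zero[unfolded this]
  have "(cmod p)\<^sup>2 * (1 - (cmod a)\<^sup>2 * (cmod p)\<^sup>2 * (2 * (1 - Re (a * q / p\<^sup>2)))) = 0"
    by algebra
  then have "(cmod a)\<^sup>2 * (cmod p)\<^sup>2 * (2 * (1 - Re (a * q / p\<^sup>2))) = 1"
    using p by simp
  then have "2 * (1 - Re (a * q / p\<^sup>2)) = 1 / ((cmod a)\<^sup>2 * (cmod p)\<^sup>2)"
    using a p by (simp add: field_simps)
  moreover have "Re (2 * (1 - c)) = 2 * (1 - Re c)" for c
    by simp
  ultimately show "Re (2 * (1 - a * q / p\<^sup>2)) = (cmod (1 / (a * p)))\<^sup>2"
    by (simp only: norm_divide norm_mult power_divide power_mult_distrib norm_one power_one)
qed

section \<open>Modular surfaces of vanishing mean curvature are horizontal\<close>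

text \<open>
  The hypothesis \<open>|F'| \<noteq> 1\<close> is used twice: it makes the denominator of the mean curvature nonzero,
  and it contradicts the value \<open>|F'| = 1\<close> that follows where \<open>f' \<noteq> 0\<close>.
\<close>

lemma zero_curvature_imp_deriv_zero:
  fixes f F :: "complex \<Rightarrow> complex"
  assumes D: "open D" and f: "f holomorphic_on D"
    and F: "\<forall>z\<in>D. F z = (f z)\<^sup>2"
    and nondegenerate: "\<And>z. z \<in> D \<Longrightarrow> cmod (deriv F z) \<noteq> 1"
    and H: "\<And>z. z \<in> D \<Longrightarrow> lorentz_mean_curvature (modular_height F) z = 0"
    and z: "z \<in> D"
  shows "deriv f z = 0"
proof (rule ccontr)
  assume nz: "deriv f z \<noteq> 0"
  have hol': "deriv f holomorphic_on D" and hol'': "deriv (deriv f) holomorphic_on D"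
    using f D by (auto intro: holomorphic_deriv)
  have df: "(f has_field_derivative deriv f w) (at w)" if "w \<in> D" for w
    using holomorphic_derivI[OF f D that] .
  have dF: "cmod (deriv F w) = 2 * cmod (f w * deriv f w)" if w: "w \<in> D" for w
  proof -
    have "((\<lambda>u. (f u)\<^sup>2) has_field_derivative 2 * (f w * deriv f w)) (at w)"
      by (auto intro!: derivative_eq_intros df[OF w])
    then have "(F has_field_derivative 2 * (f w * deriv f w)) (at w)"
      by (rule has_field_derivative_transform_within_open[OF _ D w]) (simp add: F)
    then have "deriv F w = 2 * (f w * deriv f w)" by (rule DERIV_imp_deriv)
    then show ?thesis by (simp add: norm_mult)
  qed
  define S where "S = {w \<in> D. deriv f w \<noteq> 0}"
  \<comment> \<open>The differential equation is divided by powers of \<open>f'\<close> only on the open set \<open>S\<close>; its conclusion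
    is needed at the single point \<open>z\<close>, so \<open>S\<close> may be disconnected.\<close>
  have "open (D \<inter> deriv f -` (- {0}))"
    using hol' D by (intro continuous_open_preimage holomorphic_on_imp_continuous_on) auto
  moreover have "D \<inter> deriv f -` (- {0}) = S"
    by (auto simp: S_def)
  ultimately have "open S"
    by simp
  have SD: "S \<subseteq> D" and nzS: "\<And>w. w \<in> S \<Longrightarrow> deriv f w \<noteq> 0" and zS: "z \<in> S"
    using z nz by (auto simp: S_def)
  define A where "A w = 2 * (1 - f w * deriv (deriv f) w / (deriv f w)\<^sup>2)" for w
  define B where "B w = 1 / (f w * deriv f w)" for w
  have normal_form: "f w \<noteq> 0 \<and> Re (A w) = (cmod (B w))\<^sup>2" if w: "w \<in> S" for w
  proof -
    have wD: "w \<in> D" using w SD by auto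
    note partials = partials_modular_height_square[OF D f F wD]
    have "(partial_x (modular_height F) w)\<^sup>2 + (partial_y (modular_height F) w)\<^sup>2
        = (cmod (deriv F w))\<^sup>2"
      unfolding partials(1,2) dF[OF wD]
      by (simp add: power_mult_distrib cmod_power2 norm_mult) algebra
    moreover have "(cmod (deriv F w))\<^sup>2 \<noteq> 1"
      using nondegenerate[OF wD] by (simp add: power2_eq_1_iff) (smt (verit) norm_ge_zero)
    ultimately have "1 - (partial_x (modular_height F) w)\<^sup>2 - (partial_y (modular_height F) w)\<^sup>2 \<noteq> 0"
      by linarith
    with H[OF wD] have
      "(1 - (partial_y (modular_height F) w)\<^sup>2) * partial_x (partial_x (modular_height F)) w
       + 2 * partial_x (modular_height F) w * partial_y (modular_height F) w
           * partial_y (partial_x (modular_height F)) w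
       + (1 - (partial_x (modular_height F) w)\<^sup>2) * partial_y (partial_y (modular_height F)) w = 0"
      unfolding lorentz_mean_curvature_def by (simp only: divide_eq_0_iff) simp
    then have "(cmod (deriv f w))\<^sup>2 - 2 * ((cmod (deriv f w))\<^sup>2)\<^sup>2 * (cmod (f w))\<^sup>2
           + 2 * (cmod (f w))\<^sup>2 * Re ((cnj (deriv f w))\<^sup>2 * f w * deriv (deriv f) w) = 0"
      unfolding partials curvature_numerator_identity by simp
    from curvature_numerator_zero_normal_form[OF this nzS[OF w]] show ?thesis
      by (simp add: A_def B_def)
  qed
  have "A holomorphic_on S" "B holomorphic_on S"
    unfolding A_def B_def using normal_form nzS
    by (auto intro!: holomorphic_intros holomorphic_on_subset[OF f SD]
        holomorphic_on_subset[OF hol' SD] holomorphic_on_subset[OF hol'' SD])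
  with \<open>open S\<close> have "deriv B z = 0"
    using normal_form zS by (intro Re_eq_norm_squared_imp_deriv_zero[of S A B]) auto
  moreover have "(B has_field_derivative
      - ((deriv f z)\<^sup>2 + f z * deriv (deriv f) z) / (f z * deriv f z)\<^sup>2) (at z)"
    unfolding B_def using normal_form[OF zS] nz df[OF z] holomorphic_derivI[OF hol' D z]
    by (auto intro!: derivative_eq_intros simp: power2_eq_square)
  ultimately have "f z * deriv (deriv f) z = - (deriv f z)\<^sup>2"
    using normal_form[OF zS] nz by (auto dest!: DERIV_imp_deriv simp: add_eq_0_iff)
  then have "A z = 4"
    using nz by (simp add: A_def)
  with normal_form[OF zS] have "(cmod (B z))\<^sup>2 = 2\<^sup>2"
    by simp
  then have "cmod (B z) = 2"
    by (rule power2_eq_imp_eq) auto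
  then have "cmod (deriv F z) = 1"
    using dF[OF z] by (auto simp: B_def norm_divide divide_eq_eq simp del: norm_mult split: if_splits)
  with nondegenerate[OF z] show False by simp
qed

theorem theorem4p1:
  fixes D :: "complex set" and f F :: "complex \<Rightarrow> complex"
  assumes "open D" and "connected D"
    and "f analytic_on D"
    and "\<And>z. z \<in> D \<Longrightarrow> F z = (f z)\<^sup>2"
    and "maximal_modular_surface D F \<or> timelike_minimal_modular_surface D F"
  shows "\<exists>P :: (real ^ 3) set. affine P \<and> aff_dim P = 2 \<and> modular_surface D F \<subseteq> P"
proof -
  have f: "f holomorphic_on D"
    using assms(3) by (rule analytic_imp_holomorphic)
  have nondegenerate: "cmod (deriv F z) \<noteq> 1"
    and H: "lorentz_mean_curvature (modular_height F) z = 0" if "z \<in> D" for z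
    using assms(5) that
    by (auto simp: maximal_modular_surface_def timelike_minimal_modular_surface_def
        spacelike_modular_surface_def timelike_modular_surface_def)
  have "(f has_field_derivative 0) (at z)" if "z \<in> D" for z
    using zero_curvature_imp_deriv_zero[OF assms(1) f _ nondegenerate H that] assms(4)
      holomorphic_derivI[OF f assms(1) that] by simp
  then obtain c where "\<And>z. z \<in> D \<Longrightarrow> f z = c"
    using DERIV_zero_connected_constant[OF assms(2,1) finite.emptyI]
      holomorphic_on_imp_continuous_on[OF f] by (metis Diff_iff)
  then have height: "modular_height F z = cmod (c\<^sup>2)" if "z \<in> D" for z
    using that by (simp add: modular_height_def assms(4))
  define P :: "(real ^ 3) set" where "P = {x. axis 3 1 \<bullet> x = cmod (c\<^sup>2)}"
  have "affine P"
    unfolding P_def by (rule affine_hyperplane)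
  moreover have "aff_dim P = 2"
    unfolding P_def by (subst aff_dim_hyperplane) (auto simp: axis_eq_0_iff)
  moreover have "modular_surface D F \<subseteq> P"
    by (auto simp: modular_surface_def P_def inner_axis' vector_3 height)
  ultimately show ?thesis by blast
qed

end
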